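(* Let $a\in\mathbb{R}$, let $n>0$ be an even integer, and let $f:[0,2\pi)\to\mathbb{R}$ be a $2\pi$-periodic bandlimited function given by a truncated Fourier series $$f(t)=\sum_{k=-n/2}^{n/2-1}c_k e^{ikt},$$ with coefficients $c_k\in\mathbb{C}$. Then there exists a unique representation of $f$ in the form $$f(t)=a_0+a_1\sin(t-a)+\sum_{k=-n/2+1}^{n/2-2}b_k\,\sin^2\!\left(\frac{t-a}{2}\right)e^{ikt},$$ with coefficients $a_0,a_1,\{b_k\}$ given by $$b_{-n/2+1}=-4e^{-ia}c_{-n/2},\qquad b_{-n/2+2}=2e^{-ia}\left(b_{-n/2+1}-2c_{-n/2+1}\right),$$ $$b_{n/2-2}=-4e^{ia}c_{n/2-1},\qquad b_{n/2-3}=2e^{ia}\left(b_{n/2-2}-2c_{n/2-2}\right),$$ $$b_k=e^{ia}\left(2b_{k+1}-e^{ia}b_{k+2}-4c_{k+2}\right),\qquad k=n/2-4,\,n/2-5,\dots,1,$$ $$b_k=e^{-ia}\left(2b_{k-1}-e^{-ia}b_{k-2}-4c_{k}\right),\qquad k=-n/2+3,\,-n/2+4,\dots,-1,$$ $$a_0=d_2-\frac{b_0}{2},\qquad b_0=-2\left(e^{ia}d_1+e^{-ia}d_3\right),\qquad a_1=i\left(e^{ia}d_1-e^{-ia}d_3\right),$$ with $$d_1=-\frac12 b_1+\frac{e^{ia}}{4}b_2+c_1,\qquad d_2=\frac{e^{-ia}}{4}b_{-1}+\frac{e^{ia}}{4}b_1+c_0,\qquad d_3=-\frac12 b_{-1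}+\frac{e^{-ia}}{4}b_{-2}+c_{-1}.$$
   Context: The functions $1$, $\sin(t-a)$, and $\sin^2((t-a)/2)e^{ikt}$ for $k=-n/2+1,\dots,n/2-2$ form the "modified Fourier basis" of order $n$ centered at the shift parameter $a$. The recurrences for $b_k$ are evaluated in the order of the listed indices, from the largest $|k|$ inwards.
   Formalization: The recurrences for b_k use c_{k+1} and c_{k-1} in place of c_{k+2} and c_k, which make the claim false; for n<8 the starting values from -n/2 are imposed only at negative indices, those from n/2-1 only at positive ones, and b_0 has only its own formula. *)

theory Defs
  imports Complex_Main
begin

definition fourier_band :: "int \<Rightarrow> int set" where
  "fourier_band n = {-(n div 2) .. n div 2 - 1}"

definition mfb_band :: "int \<Rightarrow> int set" where
  "mfb_band n = {-(n div 2) + 1 .. n div 2 - 2}"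

definition supported_on :: "int set \<Rightarrow> (int \<Rightarrow> complex) \<Rightarrow> bool" where
  "supported_on K u \<longleftrightarrow> (\<forall>k. k \<notin> K \<longrightarrow> u k = 0)"

definition fourier_sum :: "int \<Rightarrow> (int \<Rightarrow> complex) \<Rightarrow> real \<Rightarrow> complex" where
  "fourier_sum n c t = (\<Sum>k\<in>fourier_band n. c k * exp (\<i> * of_int k * of_real t))"

definition mfb_sum ::
  "int \<Rightarrow> real \<Rightarrow> complex \<Rightarrow> complex \<Rightarrow> (int \<Rightarrow> complex) \<Rightarrow> real \<Rightarrow> complex" where
  "mfb_sum n a a0 a1 b t =
     a0 + a1 * of_real (sin (t - a))
     + (\<Sum>k\<in>mfb_band n.
          b k * (of_real ((sin ((t - a) / 2))\<^sup>2) * exp (\<i> * of_int k * of_real t)))"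

(* A finite coefficient family is encoded as a function on all integers that vanishes
   off its index range; this makes uniqueness of b meaningful. *)
definition mfb_representation ::
  "int \<Rightarrow> real \<Rightarrow> (real \<Rightarrow> real) \<Rightarrow> complex \<Rightarrow> complex \<Rightarrow> (int \<Rightarrow> complex) \<Rightarrow> bool" where
  "mfb_representation n a f a0 a1 b \<longleftrightarrow>
     supported_on (mfb_band n) b \<and>
     (\<forall>t\<in>{0..<2 * pi}. complex_of_real (f t) = mfb_sum n a a0 a1 b t)"

definition mfb_d1 :: "real \<Rightarrow> (int \<Rightarrow> complex) \<Rightarrow> (int \<Rightarrow> complex) \<Rightarrow> complex" where
  "mfb_d1 a c b = - (1 / 2) * b 1 + exp (\<i> * of_real a) / 4 * b 2 + c 1"

definition mfb_d2 :: "real \<Rightarrow> (int \<Rightarrow> complex) \<Rightarrow> (int \<Rightarrow> complex) \<Rightarrow> complex" where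
  "mfb_d2 a c b = exp (- \<i> * of_real a) / 4 * b (-1) + exp (\<i> * of_real a) / 4 * b 1 + c 0"

definition mfb_d3 :: "real \<Rightarrow> (int \<Rightarrow> complex) \<Rightarrow> (int \<Rightarrow> complex) \<Rightarrow> complex" where
  "mfb_d3 a c b = - (1 / 2) * b (-1) + exp (- \<i> * of_real a) / 4 * b (-2) + c (-1)"

(* The guards on the four starting values matter only for n < 8. There the starting
   indices can reach 0 or change sign; the formulas started at -n/2 produce negative
   indices only, those started at n/2 - 1 positive ones only, and b 0 always comes from
   its own formula.

   Comparing the coefficients of exp (i (k + 1) t), respectively exp (i (k - 1) t), puts
   c (k + 1) and c (k - 1) into the two three-term recurrences. The source
   paper prints c (k + 2) and c k, which is a misprint: for a = 0 and f t = 2 cos (2 t) the printed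
   forms give b (-1) = 0 when n = 8 and b 1 = 0 when n = 10, and the resulting expansion
   has no exp (-2 i t), respectively exp (2 i t), term. *)
definition mfb_coefficients ::
  "int \<Rightarrow> real \<Rightarrow> (int \<Rightarrow> complex) \<Rightarrow> complex \<Rightarrow> complex \<Rightarrow> (int \<Rightarrow> complex) \<Rightarrow> bool" where
  "mfb_coefficients n a c a0 a1 b \<longleftrightarrow>
     (let N = n div 2; e = exp (\<i> * of_real a); e' = exp (- \<i> * of_real a);
          d1 = mfb_d1 a c b; d2 = mfb_d2 a c b; d3 = mfb_d3 a c b
      in supported_on (mfb_band n) b
       \<and> (- N + 1 < 0 \<longrightarrow> b (- N + 1) = - 4 * e' * c (- N))
       \<and> (- N + 2 < 0 \<longrightarrow> b (- N + 2) = 2 * e' * (b (- N + 1) - 2 * c (- N + 1)))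
       \<and> (N - 2 > 0 \<longrightarrow> b (N - 2) = - 4 * e * c (N - 1))
       \<and> (N - 3 > 0 \<longrightarrow> b (N - 3) = 2 * e * (b (N - 2) - 2 * c (N - 2)))
       \<and> (\<forall>k\<in>{1..N - 4}. b k = e * (2 * b (k + 1) - e * b (k + 2) - 4 * c (k + 1)))
       \<and> (\<forall>k\<in>{- N + 3..-1}. b k = e' * (2 * b (k - 1) - e' * b (k - 2) - 4 * c (k - 1)))
       \<and> a0 = d2 - b 0 / 2
       \<and> b 0 = - 2 * (e * d1 + e' * d3)
       \<and> a1 = \<i> * (e * d1 - e' * d3))"

end

theory Submission
  imports Defs
begin

text \<open>Since \<open>sin\<^sup>2 ((t - a) / 2) = 1/2 - exp (- \<i> a) exp (\<i> t) / 4 - exp (\<i> a) exp (- \<i> t) / 4\<close>, a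
  modified Fourier sum is a trigonometric polynomial, and by linear independence of the exponentials
  it represents \<open>f\<close> iff its Fourier coefficients are those of \<open>f\<close>. The equation at frequency
  \<open>m \<ge> 2\<close> determines \<open>b (m - 1)\<close> from \<open>b m\<close> and \<open>b (m + 1)\<close>, the one at \<open>m \<le> - 2\<close> determines
  \<open>b (m + 1)\<close> from \<open>b m\<close> and \<open>b (m - 1)\<close>, and those at \<open>- 1, 0, 1\<close> give \<open>b 0\<close>, \<open>a0\<close>, \<open>a1\<close>. As \<open>b\<close>
  vanishes for large indices, the system is triangular. Only for \<open>n = 2\<close> is \<open>b 0\<close> outside its
  index range; then the real-valuedness of \<open>f\<close> is needed, which forces \<open>c (- 1) = 0\<close>.\<close>

section \<open>Linear independence of the exponentials\<close>

text \<open>Multiplied by \<open>cis (M * t)\<close>, the sum becomes a polynomial in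
  \<open>cis t\<close> of degree at most \<open>2 * M\<close>. A nonzero coefficient would allow it
  only finitely many roots, whereas \<open>cis\<close> is injective on \<open>{0..pi}\<close> and
  supplies infinitely many.\<close>

lemma trig_poly_coeff_zero:
  fixes u :: "int \<Rightarrow> complex"
  assumes zero: "\<And>t. t \<in> {0..<2 * pi} \<Longrightarrow>
      (\<Sum>k\<in>{-int M..int M}. u k * exp (\<i> * of_int k * of_real t)) = 0"
    and k: "k \<in> {-int M..int M}"
  shows "u k = 0"
proof (rule ccontr)
  assume nz: "u k \<noteq> 0"
  define v where "v j = u (int j - int M)" for j
  let ?R = "{z. (\<Sum>j\<le>2 * M. v j * z ^ j) = 0}"
  have "v (nat (k + int M)) \<noteq> 0" "nat (k + int M) \<le> 2 * M"
    using nz k by (auto simp: v_def)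
  then have fin: "finite ?R"
    by (rule polyfun_roots_finite)
  have "cis t \<in> ?R" if t: "t \<in> {0..pi}" for t
  proof -
    have "(\<Sum>j\<le>2 * M. v j * cis t ^ j) =
        (\<Sum>k\<in>{-int M..int M}. u k * cis (of_int (k + int M) * t))"
      by (rule sum.reindex_bij_witness[of _ "\<lambda>k. nat (k + int M)" "\<lambda>j. int j - int M"])
        (auto simp: v_def DeMoivre)
    also have "\<dots> = cis (of_int (int M) * t) *
        (\<Sum>k\<in>{-int M..int M}. u k * exp (\<i> * of_int k * of_real t))"
      unfolding sum_distrib_left
      by (intro sum.cong refl) (simp add: cis_conv_exp exp_add[symmetric] algebra_simps)
    also have "\<dots> = 0"
    proof -
      have "t \<in> {0..<2 * pi}" using t pi_gt_zero by (auto simp del: pi_gt_zero)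
      then show ?thesis using zero by simp
    qed
    finally show ?thesis by simp
  qed
  then have "cis ` {0..pi} \<subseteq> ?R" by blast
  then have "finite (cis ` {0..pi})" using fin by (rule finite_subset)
  moreover have "inj_on cis {0..pi}"
    by (rule inj_onI) (auto simp: complex_eq_iff intro: cos_inj_pi)
  ultimately have "finite {0..pi}" by (rule finite_imageD)
  then show False using infinite_Icc[OF pi_gt_zero] by simp
qed

section \<open>Fourier coefficients of a modified Fourier sum\<close>

text \<open>The squared sine spreads each \<open>b k\<close> over the frequencies
  \<open>k - 1\<close>, \<open>k\<close>, \<open>k + 1\<close>; the conditional terms come from the
  constant and from \<open>sin (t - a)\<close>.\<close>

definition mfb_fourier_coeff ::
  "real \<Rightarrow> complex \<Rightarrow> complex \<Rightarrow> (int \<Rightarrow> complex) \<Rightarrow> int \<Rightarrow> complex" where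
  "mfb_fourier_coeff a a0 a1 b m =
     b m / 2 - exp (- \<i> * of_real a) / 4 * b (m - 1) - exp (\<i> * of_real a) / 4 * b (m + 1)
     + (if m = 0 then a0 else 0)
     + (if m = 1 then exp (- \<i> * of_real a) * a1 / (2 * \<i>) else 0)
     - (if m = -1 then exp (\<i> * of_real a) * a1 / (2 * \<i>) else 0)"

lemma of_real_sin_exp:
  "complex_of_real (sin (t - a)) =
     (exp (- \<i> * of_real a) * exp (\<i> * of_real t)
      - exp (\<i> * of_real a) * exp (- \<i> * of_real t)) / (2 * \<i>)"
proof -
  have "2 * \<i> * complex_of_real (sin (t - a)) = cis (t - a) - cis (a - t)"
    using sin_minus[of "t - a"] cos_minus[of "t - a"]
    by (simp add: complex_eq_iff)
  then show ?thesis
    by (simp add: cis_conv_exp exp_add[symmetric] field_simps)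
qed

lemma of_real_sin_squared_half_exp:
  "complex_of_real ((sin ((t - a) / 2))\<^sup>2) =
     1 / 2 - exp (- \<i> * of_real a) * exp (\<i> * of_real t) / 4
       - exp (\<i> * of_real a) * exp (- \<i> * of_real t) / 4"
proof -
  have "cos (t - a) = cos (2 * ((t - a) / 2))"
    by (simp add: diff_divide_distrib)
  also have "\<dots> = 1 - 2 * (sin ((t - a) / 2))\<^sup>2" by (rule cos_double_sin)
  finally have "(sin ((t - a) / 2))\<^sup>2 = 1 / 2 - cos (t - a) / 2"
    by (simp add: diff_divide_distrib)
  then have "complex_of_real ((sin ((t - a) / 2))\<^sup>2) = 1 / 2 - cis (t - a) / 4 - cis (a - t) / 4"
    using sin_minus[of "t - a"] cos_minus[of "t - a"]
    by (simp add: complex_eq_iff)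
  then show ?thesis
    by (simp add: cis_conv_exp exp_add[symmetric] algebra_simps)
qed

lemma sum_shift_supported:
  fixes b F :: "int \<Rightarrow> complex"
  assumes "supported_on {p..q} b" "l \<le> p + s" "q + s \<le> r"
  shows "(\<Sum>k\<in>{l..r}. b (k - s) * F k) = (\<Sum>k\<in>{p..q}. b k * F (k + s))"
proof -
  have "(\<Sum>k\<in>{l..r}. b (k - s) * F k) = (\<Sum>k\<in>{p + s..q + s}. b (k - s) * F k)"
    using assms by (intro sum.mono_neutral_right) (auto simp: supported_on_def)
  also have "\<dots> = (\<Sum>k\<in>{p..q}. b k * F (k + s))"
    by (rule sum.reindex_bij_witness[of _ "\<lambda>k. k + s" "\<lambda>k. k - s"]) auto
  finally show ?thesis .
qed

text \<open>The window must contain \<open>mfb_band n\<close> shifted by one either way, hence the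
  first bound on \<open>M\<close>, and the frequencies -1, 0, 1 of the constant and the sine, hence
  \<open>0 < M\<close>.\<close>

lemma mfb_sum_eq_trig_poly:
  assumes b: "supported_on (mfb_band n) b" and M: "n div 2 \<le> int M" "0 < M"
  shows "mfb_sum n a a0 a1 b t =
    (\<Sum>k\<in>{-int M..int M}. mfb_fourier_coeff a a0 a1 b k * exp (\<i> * of_int k * of_real t))"
proof -
  define E where "E k = exp (\<i> * of_int k * complex_of_real t)" for k :: int
  define e e' where "e = exp (\<i> * complex_of_real a)" and "e' = exp (- \<i> * complex_of_real a)"
  have Eadd: "E (j + k) = E j * E k" for j k
    by (simp add: E_def exp_add[symmetric] algebra_simps)
  have E1: "E 1 = exp (\<i> * complex_of_real t)" "E (-1) = exp (- \<i> * complex_of_real t)" "E 0 = 1"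
    by (simp_all add: E_def)
  let ?I = "{-int M..int M}"
  have shift: "(\<Sum>k\<in>?I. b (k - s) * E k) = (\<Sum>k\<in>mfb_band n. b k * E (k + s))"
    if "s \<in> {-1..1}" for s
    unfolding mfb_band_def using b M that
    by (intro sum_shift_supported) (auto simp: mfb_band_def)
  have delta: "(\<Sum>k\<in>?I. (if k = j then x else 0) * E k) = x * E j" if "j \<in> ?I" for j x
  proof -
    have "(\<Sum>k\<in>?I. (if k = j then x else 0) * E k) = (\<Sum>k\<in>?I. if k = j then x * E j else 0)"
      by (intro sum.cong) auto
    then show ?thesis using that by simp
  qed
  \<comment> \<open>The forms \<open>k - 0\<close> and \<open>k - (-1)\<close> let
    \<open>shift\<close> rewrite all three sums.\<close>
  have "(\<Sum>k\<in>?I. mfb_fourier_coeff a a0 a1 b k * E k) =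
      (\<Sum>k\<in>?I. b (k - 0) * E k) / 2 - e' / 4 * (\<Sum>k\<in>?I. b (k - 1) * E k)
      - e / 4 * (\<Sum>k\<in>?I. b (k - (-1)) * E k)
      + (\<Sum>k\<in>?I. (if k = 0 then a0 else 0) * E k)
      + (\<Sum>k\<in>?I. (if k = 1 then e' * a1 / (2 * \<i>) else 0) * E k)
      - (\<Sum>k\<in>?I. (if k = -1 then e * a1 / (2 * \<i>) else 0) * E k)"
    unfolding mfb_fourier_coeff_def e_def[symmetric] e'_def[symmetric]
      sum_distrib_left sum_divide_distrib sum.distrib[symmetric] sum_subtractf[symmetric]
    by (intro sum.cong refl) (simp add: algebra_simps)
  also have "\<dots> = (\<Sum>k\<in>mfb_band n. b k * (1 / 2 - e' * E 1 / 4 - e * E (-1) / 4) * E k)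
      + a0 + a1 * ((e' * E 1 - e * E (-1)) / (2 * \<i>))"
  proof -
    have "(\<Sum>k\<in>mfb_band n. b k * (1 / 2 - e' * E 1 / 4 - e * E (-1) / 4) * E k) =
        (\<Sum>k\<in>mfb_band n. b k * E (k + 0)) / 2 - e' / 4 * (\<Sum>k\<in>mfb_band n. b k * E (k + 1))
        - e / 4 * (\<Sum>k\<in>mfb_band n. b k * E (k + (-1)))"
      unfolding sum_distrib_left sum_divide_distrib sum.distrib[symmetric] sum_subtractf[symmetric]
        Eadd E1(3)
      by (intro sum.cong refl) (simp add: algebra_simps)
    moreover have "(0::int) \<in> ?I" "1 \<in> ?I" "-1 \<in> ?I" using M(2) by auto
    moreover have "(0::int) \<in> {-1..1}" "(1::int) \<in> {-1..1}" "(-1::int) \<in> {-1..1}" by auto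
    ultimately show ?thesis
      by (simp only: shift delta E1(3)) (simp add: diff_divide_distrib ring_distribs mult_ac)
  qed
  also have "\<dots> = mfb_sum n a a0 a1 b t"
    unfolding mfb_sum_def of_real_sin_exp of_real_sin_squared_half_exp
      E1 e_def e'_def
    by (simp add: E_def mult.assoc)
  finally show ?thesis unfolding E_def by simp
qed

lemma fourier_sum_eq_trig_poly:
  assumes "supported_on (fourier_band n) c" "n div 2 \<le> int M"
  shows "fourier_sum n c t = (\<Sum>k\<in>{-int M..int M}. c k * exp (\<i> * of_int k * of_real t))"
  unfolding fourier_sum_def using assms
  by (intro sum.mono_neutral_left) (auto simp: supported_on_def fourier_band_def)

lemma mfb_representation_iff_fourier_coeff:
  assumes n: "n > 0"
    and c: "supported_on (fourier_band n) c"
    and f: "\<And>t. t \<in> {0..<2 * pi} \<Longrightarrow> complex_of_real (f t) = fourier_sum n c t"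
  shows "mfb_representation n a f a0 a1 b \<longleftrightarrow>
    supported_on (mfb_band n) b \<and> (\<forall>m. mfb_fourier_coeff a a0 a1 b m = c m)"
proof (cases "supported_on (mfb_band n) b")
  case True
  define M where "M = nat (n div 2) + 1"
  have M: "n div 2 \<le> int M" "0 < M" by (auto simp: M_def)
  let ?w = "mfb_fourier_coeff a a0 a1 b"
  have "?w m = c m"
    if eq: "\<forall>t\<in>{0..<2 * pi}. fourier_sum n c t = mfb_sum n a a0 a1 b t" for m
  proof (cases "m \<in> {-int M..int M}")
    case True
    have "?w m - c m = 0"
    proof (rule trig_poly_coeff_zero[where M = M and u = "\<lambda>k. ?w k - c k"])
      show "(\<Sum>k\<in>{-int M..int M}. (?w k - c k) * exp (\<i> * of_int k * of_real t)) = 0"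
        if "t \<in> {0..<2 * pi}" for t
        using eq that unfolding left_diff_distrib sum_subtractf
          mfb_sum_eq_trig_poly[OF \<open>supported_on (mfb_band n) b\<close> M, symmetric]
          fourier_sum_eq_trig_poly[OF c M(1), symmetric] by simp
    qed fact
    then show ?thesis by simp
  next
    \<comment> \<open>Outside the window the three values of \<open>b\<close>, the conditional terms
      and \<open>c m\<close> all vanish.\<close>
    case False
    then have "m > n div 2 \<and> m > 1 \<or> m < - (n div 2) \<and> m < -1"
      using n by (auto simp: M_def)
    then show ?thesis using \<open>supported_on (mfb_band n) b\<close> c
      by (auto simp: mfb_fourier_coeff_def supported_on_def mfb_band_def fourier_band_def)
  qed
  moreover have "fourier_sum n c t = mfb_sum n a a0 a1 b t" if "\<forall>m. ?w m = c m" for t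
    using that by (simp add: mfb_sum_eq_trig_poly[OF True M] fourier_sum_eq_trig_poly[OF c M(1)])
  ultimately show ?thesis
    using True f by (auto simp: mfb_representation_def)
qed (simp add: mfb_representation_def)

section \<open>Removing the starting values from the recurrences\<close>

text \<open>Requiring the three-term recurrences at all nonzero indices absorbs the starting values,
  and with them the guards for small \<open>n\<close>.\<close>

definition mfb_recurrence ::
  "int \<Rightarrow> real \<Rightarrow> (int \<Rightarrow> complex) \<Rightarrow> complex \<Rightarrow> complex \<Rightarrow> (int \<Rightarrow> complex) \<Rightarrow> bool" where
  "mfb_recurrence n a c a0 a1 b \<longleftrightarrow>
     (let e = exp (\<i> * of_real a); e' = exp (- \<i> * of_real a)
      in supported_on (mfb_band n) b
       \<and> (\<forall>k\<ge>1. b k = e * (2 * b (k + 1) - e * b (k + 2) - 4 * c (k + 1)))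
       \<and> (\<forall>k\<le>-1. b k = e' * (2 * b (k - 1) - e' * b (k - 2) - 4 * c (k - 1)))
       \<and> a0 = mfb_d2 a c b - b 0 / 2
       \<and> b 0 = - 2 * (e * mfb_d1 a c b + e' * mfb_d3 a c b)
       \<and> a1 = \<i> * (e * mfb_d1 a c b - e' * mfb_d3 a c b))"

text \<open>Beyond the band the recurrence reads 0 = 0. At the two outermost indices on either side,
  the terms that leave the band drop out, and what remains is the formula for a starting
  value.\<close>

lemma mfb_coefficients_iff_recurrence:
  assumes c: "supported_on (fourier_band n) c"
  shows "mfb_coefficients n a c a0 a1 b \<longleftrightarrow> mfb_recurrence n a c a0 a1 b"
proof (cases "supported_on (mfb_band n) b")
  case True
  define N where "N = n div 2"
  define e e' where "e = exp (\<i> * complex_of_real a)" and "e' = exp (- \<i> * complex_of_real a)"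
  have b0: "b k = 0" if "k \<le> - N \<or> k \<ge> N - 1" for k
    using True that by (auto simp: supported_on_def mfb_band_def N_def)
  have c0: "c k = 0" if "k < - N \<or> k \<ge> N" for k
    using c that by (auto simp: supported_on_def fourier_band_def N_def)
  let ?P = "\<lambda>k. b k = e * (2 * b (k + 1) - e * b (k + 2) - 4 * c (k + 1))"
  let ?Q = "\<lambda>k. b k = e' * (2 * b (k - 1) - e' * b (k - 2) - 4 * c (k - 1))"
  have split_pos: "(\<forall>k\<ge>1. P k) \<longleftrightarrow>
      (N - 2 > 0 \<longrightarrow> P (N - 2)) \<and> (N - 3 > 0 \<longrightarrow> P (N - 3)) \<and> (\<forall>k\<in>{1..N - 4}. P k)"
    (is "_ \<longleftrightarrow> ?R") if P: "\<And>k. k \<ge> N - 1 \<Longrightarrow> P k" for P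
  proof (intro iffI allI impI)
    fix k :: int assume R: ?R and k: "1 \<le> k"
    consider "k \<ge> N - 1" | "k = N - 2" | "k = N - 3" | "k \<in> {1..N - 4}"
      using k by fastforce
    then show "P k" using R k by cases (auto intro: P)
  qed simp
  have split_neg: "(\<forall>k\<le>-1. P k) \<longleftrightarrow>
      (- N + 1 < 0 \<longrightarrow> P (- N + 1)) \<and> (- N + 2 < 0 \<longrightarrow> P (- N + 2)) \<and> (\<forall>k\<in>{- N + 3..-1}. P k)"
    (is "_ \<longleftrightarrow> ?R") if P: "\<And>k. k \<le> - N \<Longrightarrow> P k" for P
  proof (intro iffI allI impI)
    fix k :: int assume R: ?R and k: "k \<le> -1"
    consider "k \<le> - N" | "k = - N + 1" | "k = - N + 2" | "k \<in> {- N + 3..-1}"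
      using k by fastforce
    then show "P k" using R k by cases (auto intro: P)
  qed simp
  have ends: "?P (N - 2) \<longleftrightarrow> b (N - 2) = - 4 * e * c (N - 1)"
    "?P (N - 3) \<longleftrightarrow> b (N - 3) = 2 * e * (b (N - 2) - 2 * c (N - 2))"
    "?Q (- N + 1) \<longleftrightarrow> b (- N + 1) = - 4 * e' * c (- N)"
    "?Q (- N + 2) \<longleftrightarrow> b (- N + 2) = 2 * e' * (b (- N + 1) - 2 * c (- N + 1))"
    by (simp_all add: b0 algebra_simps)
  have "(\<forall>k\<ge>1. ?P k) \<longleftrightarrow> (N - 2 > 0 \<longrightarrow> b (N - 2) = - 4 * e * c (N - 1)) \<and>
      (N - 3 > 0 \<longrightarrow> b (N - 3) = 2 * e * (b (N - 2) - 2 * c (N - 2))) \<and> (\<forall>k\<in>{1..N - 4}. ?P k)"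
    by (subst split_pos) (simp add: b0 c0, simp only: ends)
  moreover have "(\<forall>k\<le>-1. ?Q k) \<longleftrightarrow> (- N + 1 < 0 \<longrightarrow> b (- N + 1) = - 4 * e' * c (- N)) \<and>
      (- N + 2 < 0 \<longrightarrow> b (- N + 2) = 2 * e' * (b (- N + 1) - 2 * c (- N + 1))) \<and>
      (\<forall>k\<in>{- N + 3..-1}. ?Q k)"
    by (subst split_neg) (simp add: b0 c0, simp only: ends)
  ultimately show ?thesis
    unfolding mfb_coefficients_def mfb_recurrence_def Let_def
      e_def[symmetric] e'_def[symmetric] N_def[symmetric]
    by (simp only: conj_ac)
qed (simp add: mfb_coefficients_def mfb_recurrence_def Let_def)

section \<open>Coefficient equations as recurrences\<close>

text \<open>The neighbour of \<open>b m\<close> nearer to 0 enters the equation at frequency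
  \<open>m\<close> with factor \<open>- e' / 4\<close> or \<open>- e / 4\<close>. Scaling by
  \<open>- 4 * e\<close> or \<open>- 4 * e'\<close> therefore solves for it.\<close>

lemma fourier_coeff_iff_recurrence:
  "supported_on (mfb_band n) b \<and> (\<forall>m. mfb_fourier_coeff a a0 a1 b m = c m) \<longleftrightarrow>
   mfb_recurrence n a c a0 a1 b"
proof -
  define e e' where "e = exp (\<i> * complex_of_real a)" and "e' = exp (- \<i> * complex_of_real a)"
  have ee: "e * e' = 1" by (simp add: e_def e'_def exp_add[symmetric])
  have nz: "e \<noteq> 0" "e' \<noteq> 0" by (simp_all add: e_def e'_def)
  have e': "e' = 1 / e" using ee nz by (simp add: field_simps)
  let ?w = "mfb_fourier_coeff a a0 a1 b"
  note w = mfb_fourier_coeff_def[of a, folded e_def e'_def]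
  have "b k - e * (2 * b (k + 1) - e * b (k + 2) - 4 * c (k + 1)) =
      - 4 * e * (?w (k + 1) - c (k + 1))" if "k \<ge> 1" for k
    using that nz unfolding w e' by (simp add: field_simps)
  then have pos: "?w (k + 1) = c (k + 1) \<longleftrightarrow>
      b k = e * (2 * b (k + 1) - e * b (k + 2) - 4 * c (k + 1))" if "k \<ge> 1" for k
    using that nz by (metis eq_iff_diff_eq_0 mult_eq_0_iff neg_equal_0_iff_equal zero_neq_numeral)
  have "b k - e' * (2 * b (k - 1) - e' * b (k - 2) - 4 * c (k - 1)) =
      - 4 * e' * (?w (k - 1) - c (k - 1))" if "k \<le> -1" for k
    using that nz unfolding w e' by (simp add: field_simps)
  then have neg: "?w (k - 1) = c (k - 1) \<longleftrightarrow>
      b k = e' * (2 * b (k - 1) - e' * b (k - 2) - 4 * c (k - 1))" if "k \<le> -1" for k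
    using that nz by (metis eq_iff_diff_eq_0 mult_eq_0_iff neg_equal_0_iff_equal zero_neq_numeral)
  have "a0 - (mfb_d2 a c b - b 0 / 2) = ?w 0 - c 0"
    unfolding w mfb_d2_def e_def[symmetric] e'_def[symmetric] by (simp add: field_simps)
  then have zero: "?w 0 = c 0 \<longleftrightarrow> a0 = mfb_d2 a c b - b 0 / 2"
    by (metis eq_iff_diff_eq_0)
  \<comment> \<open>\<open>mfb_d1\<close> and, at frequency -1, \<open>mfb_d3\<close> collect the
    terms free of \<open>b 0\<close> and \<open>a1\<close>.\<close>
  have "b 0 + 2 * \<i> * a1 - (- 4 * e * mfb_d1 a c b) = - 4 * e * (?w 1 - c 1)"
    using nz unfolding w mfb_d1_def e_def[symmetric] unfolding e' by (simp add: field_simps)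
  then have one: "?w 1 = c 1 \<longleftrightarrow> b 0 + 2 * \<i> * a1 = - 4 * e * mfb_d1 a c b"
    using nz by (metis eq_iff_diff_eq_0 mult_eq_0_iff neg_equal_0_iff_equal zero_neq_numeral)
  have "b 0 - 2 * \<i> * a1 - (- 4 * e' * mfb_d3 a c b) = - 4 * e' * (?w (-1) - c (-1))"
    using nz unfolding w mfb_d3_def e_def[symmetric] e'_def[symmetric] unfolding e'
    by (simp add: field_simps)
  then have minus_one: "?w (-1) = c (-1) \<longleftrightarrow> b 0 - 2 * \<i> * a1 = - 4 * e' * mfb_d3 a c b"
    using nz by (metis eq_iff_diff_eq_0 mult_eq_0_iff neg_equal_0_iff_equal zero_neq_numeral)
  \<comment> \<open>Adding the two equations isolates \<open>b 0\<close>; subtracting them isolates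
    \<open>a1\<close>.\<close>
  have ones: "?w 1 = c 1 \<and> ?w (-1) = c (-1) \<longleftrightarrow>
      b 0 = - 2 * (e * mfb_d1 a c b + e' * mfb_d3 a c b) \<and>
      a1 = \<i> * (e * mfb_d1 a c b - e' * mfb_d3 a c b)"
    unfolding one minus_one by (auto simp: complex_eq_iff)
  have "(\<forall>m. ?w m = c m) \<longleftrightarrow> (\<forall>k\<ge>1. ?w (k + 1) = c (k + 1)) \<and>
      (\<forall>k\<le>-1. ?w (k - 1) = c (k - 1)) \<and> ?w 0 = c 0 \<and> ?w 1 = c 1 \<and> ?w (-1) = c (-1)"
    (is "_ \<longleftrightarrow> ?R")
  proof (intro iffI allI)
    fix m :: int assume R: ?R
    consider "m - 1 \<ge> 1" | "m + 1 \<le> -1" | "m = 0" | "m = 1" | "m = -1" by fastforce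
    then show "?w m = c m"
    proof cases
      case 1 then show ?thesis using R by (metis diff_add_cancel)
    next
      case 2 then show ?thesis using R by (metis add_diff_cancel_right')
    qed (use R in auto)
  qed auto
  then show ?thesis
    unfolding mfb_recurrence_def Let_def e_def[symmetric] e'_def[symmetric] ones zero
    by (simp add: pos neg)
qed

section \<open>Unique solvability of the recurrences\<close>

text \<open>Induction on the distance to \<open>M\<close>. A general \<open>F\<close> lets the lemma
  serve the negative indices too, after reflection.\<close>

lemma backward_recurrence_unique:
  fixes p q :: "int \<Rightarrow> complex"
  assumes p: "\<And>k. 1 \<le> k \<Longrightarrow> p k = F k (p (k + 1)) (p (k + 2))"
    and q: "\<And>k. 1 \<le> k \<Longrightarrow> q k = F k (q (k + 1)) (q (k + 2))"
    and big: "\<And>k. M \<le> k \<Longrightarrow> p k = q k"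
  shows "1 \<le> k \<Longrightarrow> p k = q k"
proof (induction "nat (M - k)" arbitrary: k rule: less_induct)
  case less
  show ?case
  proof (cases "M \<le> k")
    case False
    then have "p (k + 1) = q (k + 1)" "p (k + 2) = q (k + 2)"
      using less.prems by (auto intro!: less.hyps)
    then show ?thesis using p[of k] q[of k] less.prems by simp
  qed (rule big)
qed

text \<open>Counting downwards from \<open>M + 1\<close> turns the recurrence into a primitive
  recursion on pairs of consecutive values.\<close>

lemma backward_recurrence_exists:
  fixes c :: "int \<Rightarrow> complex" and e :: complex
  assumes c: "\<And>k. M < k \<Longrightarrow> c k = 0"
  shows "\<exists>q. (\<forall>k\<ge>M. q k = 0) \<and>
    (\<forall>k. q k = e * (2 * q (k + 1) - e * q (k + 2) - 4 * c (k + 1)))"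
proof -
  \<comment> \<open>The state \<open>P j\<close> is to be the pair of \<open>q (M + 1 - j)\<close>
    and \<open>q (M - j)\<close>; \<open>F\<close> moves this pair one index down.\<close>
  define F where "F j = (\<lambda>(x, y). (y, e * (2 * y - e * x - 4 * c (M - int j))))" for j
  define P where "P = rec_nat (0, 0) F"
  define q where "q k = fst (P (nat (M + 1 - k)))" for k
  have P: "P 0 = (0, 0)" "P (Suc j) = F j (P j)" for j by (simp_all add: P_def)
  have P1: "fst (P (Suc 0)) = 0" by (simp add: P F_def)
  \<comment> \<open>For \<open>k\<close> above \<open>M\<close>, \<open>nat\<close> truncates to
    stage 0; \<open>k = M\<close> is stage 1. Both stages have first component 0.\<close>
  have big: "q k = 0" if "M \<le> k" for k
  proof (cases "k = M")
    case False
    then have "nat (M + 1 - k) = 0" using that by simp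
    then show ?thesis by (simp only: q_def P fst_conv)
  qed (simp add: q_def P1)
  have step: "q k = e * (2 * q (k + 1) - e * q (k + 2) - 4 * c (k + 1))" for k
  proof (cases "M \<le> k")
    case True
    then show ?thesis by (simp add: big c)
  next
    case False
    define j where "j = nat (M - 1 - k)"
    have j: "nat (M + 1 - k) = Suc (Suc j)" "nat (M + 1 - (k + 1)) = Suc j"
      "nat (M + 1 - (k + 2)) = j" "M - int j = k + 1"
      using False by (auto simp: j_def)
    show ?thesis
      unfolding q_def j by (simp add: P F_def j(4) split: prod.split)
  qed
  show ?thesis using big step by blast
qed

text \<open>Each half-line is settled separately, starting where both solutions vanish. Then
  \<open>a0\<close>, \<open>a1\<close> and \<open>b 0\<close> follow from the values at 1, 2, -1,
  -2.\<close>

lemma mfb_recurrence_unique: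
  assumes 1: "mfb_recurrence n a c a0 a1 b" and 2: "mfb_recurrence n a c a0' a1' b'"
  shows "a0 = a0' \<and> a1 = a1' \<and> b = b'"
proof -
  define e e' where "e = exp (\<i> * complex_of_real a)" and "e' = exp (- \<i> * complex_of_real a)"
  note r = 1[unfolded mfb_recurrence_def Let_def, folded e_def e'_def]
    2[unfolded mfb_recurrence_def Let_def, folded e_def e'_def]
  have supp: "supported_on (mfb_band n) b" "supported_on (mfb_band n) b'"
    by (rule r[THEN conjunct1])+
  have pos_rec: "b k = e * (2 * b (k + 1) - e * b (k + 2) - 4 * c (k + 1))"
    "b' k = e * (2 * b' (k + 1) - e * b' (k + 2) - 4 * c (k + 1))" if "k \<ge> 1" for k
    using r[THEN conjunct2, THEN conjunct1] that by blast+
  have neg_rec: "b k = e' * (2 * b (k - 1) - e' * b (k - 2) - 4 * c (k - 1))"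
    "b' k = e' * (2 * b' (k - 1) - e' * b' (k - 2) - 4 * c (k - 1))" if "k \<le> -1" for k
    using r[THEN conjunct2, THEN conjunct2, THEN conjunct1] that by blast+
  note a0_a1_b0 = r[THEN conjunct2, THEN conjunct2, THEN conjunct2]
  \<comment> \<open>\<open>\<bar>n\<bar>\<close> is a crude bound for the band, valid for either
    sign of \<open>n\<close>.\<close>
  have far: "b k = b' k" if "\<bar>n\<bar> \<le> k \<or> k \<le> - \<bar>n\<bar>" for k
  proof -
    have "k \<notin> mfb_band n" using that by (auto simp: mfb_band_def)
    then show ?thesis using supp by (simp add: supported_on_def)
  qed
  have pos: "b k = b' k" if "1 \<le> k" for k
    by (rule backward_recurrence_unique[where M = "\<bar>n\<bar>" and
          F = "\<lambda>k x y. e * (2 * x - e * y - 4 * c (k + 1))"])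
      (fact pos_rec far that disjI1[THEN far])+
  have neg: "b (- k) = b' (- k)" if "1 \<le> k" for k
  proof (rule backward_recurrence_unique[where M = "\<bar>n\<bar>" and p = "\<lambda>k. b (- k)" and
          q = "\<lambda>k. b' (- k)" and F = "\<lambda>k x y. e' * (2 * x - e' * y - 4 * c (- k - 1))"])
    fix k :: int assume "1 \<le> k"
    then have k: "- k \<le> -1" by simp
    have minus: "- (k + 1) = - k - 1" "- (k + 2) = - k - 2" by simp_all
    show "b (- k) = e' * (2 * b (- (k + 1)) - e' * b (- (k + 2)) - 4 * c (- k - 1))"
      unfolding minus using k by (rule neg_rec)
    show "b' (- k) = e' * (2 * b' (- (k + 1)) - e' * b' (- (k + 2)) - 4 * c (- k - 1))"
      unfolding minus using k by (rule neg_rec)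
  qed (use that far in auto)
  have "mfb_d1 a c b = mfb_d1 a c b'" "mfb_d2 a c b = mfb_d2 a c b'" "mfb_d3 a c b = mfb_d3 a c b'"
    using pos[of 1] pos[of 2] neg[of 1] neg[of 2]
    by (simp_all add: mfb_d1_def mfb_d2_def mfb_d3_def)
  then have "a0 = a0'" "a1 = a1'" "b 0 = b' 0" using a0_a1_b0 by auto
  moreover have "b k = b' k" for k
  proof -
    consider "k \<ge> 1" | "- k \<ge> 1" | "k = 0" by fastforce
    then show ?thesis
      by cases (use pos[of k] neg[of "- k"] \<open>b 0 = b' 0\<close> in auto)
  qed
  ultimately show ?thesis by auto
qed

text \<open>The two half-lines are solved independently and joined at 0. For \<open>n = 2\<close>
  the band is empty, so the prescribed \<open>b 0\<close> has to be 0; this is the purpose of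
  \<open>two\<close>.\<close>

lemma mfb_recurrence_exists:
  assumes n: "n > 0" "even n"
    and c: "supported_on (fourier_band n) c"
    and two: "n = 2 \<Longrightarrow> c (-1) = 0"
  shows "\<exists>a0 a1 b. mfb_recurrence n a c a0 a1 b"
proof -
  define N where "N = n div 2"
  have N: "N \<ge> 1" "n = 2 * N" using n by (auto simp: N_def)
  define e e' where "e = exp (\<i> * complex_of_real a)" and "e' = exp (- \<i> * complex_of_real a)"
  have c0: "c k = 0" if "k < - N \<or> k \<ge> N" for k
    using c that by (auto simp: supported_on_def fourier_band_def N_def)
  have c_q: "c k = 0" if "N - 1 < k" for k using that by (simp add: c0)
  have c_r: "c (- k) = 0" if "N < k" for k using that by (simp add: c0)
  \<comment> \<open>The thresholds \<open>N - 1\<close> here and \<open>N\<close> for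
    \<open>r\<close> differ because the band is not symmetric about 0.\<close>
  obtain q where q: "\<And>k. N - 1 \<le> k \<Longrightarrow> q k = 0"
      "\<And>k. q k = e * (2 * q (k + 1) - e * q (k + 2) - 4 * c (k + 1))"
    using backward_recurrence_exists[of "N - 1" c e, OF c_q] by blast
  obtain r where r: "\<And>k. N \<le> k \<Longrightarrow> r k = 0"
      "\<And>k. r k = e' * (2 * r (k + 1) - e' * r (k + 2) - 4 * c (- (k + 1)))"
    using backward_recurrence_exists[of N "\<lambda>k. c (- k)" e', OF c_r] by blast
  define g where "g k = (if k > 0 then q k else r (- k))" for k
  \<comment> \<open>There is no circularity: \<open>mfb_d1\<close> and \<open>mfb_d3\<close> do not
    read the value at 0, so the provisional \<open>g 0\<close> is harmless.\<close>
  define b where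
    "b = g(0 := - 2 * (e * mfb_d1 a c g + e' * mfb_d3 a c g))"
  have d: "mfb_d1 a c b = mfb_d1 a c g" "mfb_d3 a c b = mfb_d3 a c g"
    by (simp_all add: b_def mfb_d1_def mfb_d3_def)
  have b0: "b 0 = - 2 * (e * mfb_d1 a c b + e' * mfb_d3 a c b)"
    unfolding d by (simp add: b_def)
  have "b k = 0" if "k \<notin> mfb_band n" for k
  proof -
    have k: "k \<le> - N \<or> k \<ge> N - 1" using that by (auto simp: mfb_band_def N)
    show ?thesis
    proof (cases "k = 0")
      case True
      then have "N = 1" using k N by auto
      then have "mfb_d1 a c g = 0" "mfb_d3 a c g = 0"
        using two q(1) r(1) by (simp_all add: mfb_d1_def mfb_d3_def g_def c0 N(2))
      then show ?thesis using True by (simp add: b_def)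
    next
      case False
      then show ?thesis using k q(1) r(1) N by (auto simp: b_def g_def)
    qed
  qed
  then have supp: "supported_on (mfb_band n) b" by (simp add: supported_on_def)
  have pos: "b k = e * (2 * b (k + 1) - e * b (k + 2) - 4 * c (k + 1))" if "k \<ge> 1" for k
    using that q(2)[of k] by (simp add: b_def g_def)
  have neg: "b k = e' * (2 * b (k - 1) - e' * b (k - 2) - 4 * c (k - 1))" if "k \<le> -1" for k
    using that r(2)[of "- k"] by (simp add: b_def g_def algebra_simps)
  show ?thesis
    unfolding mfb_recurrence_def Let_def e_def[symmetric] e'_def[symmetric]
    using supp pos neg b0 by blast
qed

text \<open>With frequencies -1 and 0 only, vanishing imaginary parts at 0 and \<open>pi\<close>
  make \<open>c (-1)\<close> and \<open>c 0\<close> real; the one at \<open>pi / 2\<close> then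
  kills the real part of \<open>c (-1)\<close>.\<close>

lemma real_fourier_sum_two:
  assumes "\<And>t. t \<in> {0..<2 * pi} \<Longrightarrow> complex_of_real (f t) = fourier_sum 2 c t"
  shows "c (-1) = 0"
proof -
  have band: "fourier_band 2 = {-1, 0}" by (auto simp: fourier_band_def)
  have "complex_of_real (f t) = c (-1) * cis (- t) + c 0" if "t \<in> {0..<2 * pi}" for t
    using assms[OF that] by (simp add: fourier_sum_def band cis_conv_exp)
  from this[of 0] this[of pi] this[of "pi / 2"] show ?thesis
    using pi_gt_zero by (auto simp: complex_eq_iff)
qed

theorem theorem3p6:
  fixes a :: real and n :: int and f :: "real \<Rightarrow> real" and c :: "int \<Rightarrow> complex"
  assumes "n > 0" and "even n"
    and "\<And>t. f (t + 2 * pi) = f t"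
    and "supported_on (fourier_band n) c"
    and "\<And>t. t \<in> {0..<2 * pi} \<Longrightarrow> complex_of_real (f t) = fourier_sum n c t"
  shows "(\<exists>!p. case p of (a0, a1, b) \<Rightarrow> mfb_representation n a f a0 a1 b) \<and>
         (\<forall>a0 a1 b. mfb_representation n a f a0 a1 b \<longleftrightarrow> mfb_coefficients n a c a0 a1 b)"
proof -
  \<comment> \<open>Both claims of the theorem are reduced to \<open>mfb_recurrence\<close>, whose
    solution exists and is unique.\<close>
  have rep: "mfb_representation n a f a0 a1 b \<longleftrightarrow> mfb_recurrence n a c a0 a1 b" for a0 a1 b
    using mfb_representation_iff_fourier_coeff[OF assms(1,4,5)]
    by (simp add: fourier_coeff_iff_recurrence)
  have "c (-1) = 0" if "n = 2"
    using real_fourier_sum_two[of f c] assms(5) that by blast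
  then obtain a0 a1 b where "mfb_recurrence n a c a0 a1 b"
    using mfb_recurrence_exists[OF assms(1,2,4)] by blast
  then have "\<exists>!p. case p of (a0, a1, b) \<Rightarrow> mfb_representation n a f a0 a1 b"
    unfolding rep by (intro ex1I[of _ "(a0, a1, b)"]) (auto dest: mfb_recurrence_unique)
  then show ?thesis
    by (simp add: rep mfb_coefficients_iff_recurrence[OF assms(4)])
qed

end
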